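(* Let $A$ be the Hurt-Sada array and let $\varphi=(1+\sqrt5)/2$. For $n\ge 1$ let $p(n)$ be the position of $n$ in row $n-1$ of $A$, i.e., the unique $i\ge 0$ such that $A[n-1,i]=n$. Then $p(n)=\lfloor (n+1)/\varphi\rfloor$ for all $n\ge 1$.
   Context: The Hurt-Sada array $A=(A[n,k])_{n,k\ge 0}$ is defined as follows. Row $0$ is $A[0,k]=k$ for all $k\ge 0$. For $n\ge 1$, row $n$ is obtained from row $n-1$ by finding the unique occurrence of $n$ in row $n-1$, say $A[n-1,i]=n$, and shifting this entry $n$ positions to the right (it jumps over the next $n$ entries): $A[n,j]=A[n-1,j]$ for $0\le j<i$; $A[n,j]=A[n-1,j+1]$ for $i\le j<i+n$; $A[n,i+n]=n$; and $A[n,j]=A[n-1,j]$ for $j>i+n$. Each row is a permutation of $\{0,1,2,\ldots\}$. *)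

theory Defs
  imports Complex_Main
begin

text \<open>The moved entry is written \<open>r i\<close>; in the recursion below, \<open>r\<close> is row \<open>n - 1\<close> and
  \<open>r i = n\<close>, so this is the entry \<open>n\<close> jumping over the next \<open>n\<close> entries
  (see \<open>hurt_sada_step\<close>).\<close>

definition jump :: "nat \<Rightarrow> nat \<Rightarrow> (nat \<Rightarrow> nat) \<Rightarrow> nat \<Rightarrow> nat" where
  "jump i n r j =
     (if j < i then r j
      else if j < i + n then r (j + 1)
      else if j = i + n then r i
      else r j)"

primrec hurt_sada :: "nat \<Rightarrow> nat \<Rightarrow> nat" where
  "hurt_sada 0 = (\<lambda>k. k)"
| "hurt_sada (Suc m) = jump (THE i. hurt_sada m i = Suc m) (Suc m) (hurt_sada m)"

definition hs_pos :: "nat \<Rightarrow> nat" where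
  "hs_pos n = (THE i. hurt_sada (n - 1) i = n)"

definition golden_ratio :: real where
  "golden_ratio = (1 + sqrt 5) / 2"

text \<open>Every row is a permutation, so the definite descriptions above are well defined.\<close>

lemma bij_jump:
  assumes "bij r"
  shows "bij (jump i n r)"
proof -
  let ?s = "\<lambda>j. if j < i then j else if j < i + n then j + 1 else if j = i + n then i else j"
  let ?t = "\<lambda>j. if j < i then j else if j = i then i + n else if j \<le> i + n then j - 1 else j"
  have "bij ?s"
    by (rule o_bij[of ?t]) (auto simp: fun_eq_iff)
  moreover have "jump i n r = r \<circ> ?s"
    by (auto simp: jump_def fun_eq_iff)
  ultimately show ?thesis
    using assms by (simp add: bij_comp)
qed

lemma bij_hurt_sada: "bij (hurt_sada n)"
  by (induction n) (simp_all add: bij_jump bij_id[unfolded id_def])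

lemma hurt_sada_ex1: "\<exists>!i. hurt_sada n i = k"
  using bij_hurt_sada[of n] by (simp add: bij_iff)

lemma hurt_sada_pred_hs_pos: "hurt_sada (n - 1) (hs_pos n) = n"
  unfolding hs_pos_def by (rule theI'[OF hurt_sada_ex1])

lemma hurt_sada_step:
  assumes "n \<ge> 1" and "hurt_sada (n - 1) i = n"
  shows "hurt_sada n j =
    (if j < i then hurt_sada (n - 1) j
     else if j < i + n then hurt_sada (n - 1) (j + 1)
     else if j = i + n then n
     else hurt_sada (n - 1) j)"
proof -
  obtain m where n: "n = Suc m"
    using assms(1) by (cases n) auto
  have "(THE i. hurt_sada m i = Suc m) = i"
    using assms(2) n hurt_sada_ex1[of m "Suc m"] by (intro the1_equality) auto
  then show ?thesis
    using assms(2) n by (simp add: jump_def)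
qed

end

theory Submission
  imports Defs
begin

text \<open>Put \<open>a n = \<lfloor>(n + 1) / \<phi>\<rfloor>\<close> and suppose \<open>p m = a m\<close> for all \<open>m < n\<close>. The entry \<open>n\<close> starts at
  position \<open>n\<close>, and the jump of \<open>m\<close> moves it one place to the left exactly when it lies in the
  window from \<open>a m + 1\<close> to \<open>a m + m\<close>. Since \<open>n \<le> a m + m\<close> is equivalent to \<open>a n \<le> m\<close>, the entry
  \<open>n\<close> rests until \<open>m = a n\<close>; from then on it moves at every step, because its position
  \<open>n + a n - m\<close> before the jump of \<open>m\<close> exceeds \<open>a m\<close> as long as \<open>m < n\<close>. Hence it is at
  position \<open>a n\<close> in row \<open>n - 1\<close>.\<close>

lemma golden_ratio_gt_1: "golden_ratio > 1"
  by (simp add: golden_ratio_def)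

lemma golden_ratio_less_2: "golden_ratio < 2"
proof -
  have "sqrt 5 < 3"
    by (rule real_less_lsqrt) simp_all
  then show ?thesis
    by (simp add: golden_ratio_def)
qed

lemma golden_ratio_square: "golden_ratio * golden_ratio = golden_ratio + 1"
  by (simp add: golden_ratio_def field_simps)

text \<open>Infinite descent, passing from \<open>(x, y)\<close> to \<open>(y, x - y)\<close>.\<close>

lemma golden_quadratic_form_zero:
  fixes x y :: nat
  assumes "x * x = x * y + y * y"
  shows "y = 0"
  using assms
proof (induction y arbitrary: x rule: less_induct)
  case (less y)
  show ?case
  proof (rule ccontr)
    assume "y \<noteq> 0"
    have "y \<le> x"
    proof (rule ccontr)
      assume "\<not> y \<le> x"
      then have "x * x \<le> x * y" by simp
      with less.prems \<open>y \<noteq> 0\<close> show False by simp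
    qed
    then obtain z where x: "x = y + z"
      using le_Suc_ex by blast
    have eq: "y * y = y * z + z * z"
      using less.prems by (simp add: x algebra_simps)
    have "z < y"
    proof (rule ccontr)
      assume "\<not> z < y"
      then have "y * y \<le> y * z" "0 < z * z"
        using \<open>y \<noteq> 0\<close> by simp_all
      with eq show False by linarith
    qed
    from less.IH[OF this eq] eq \<open>y \<noteq> 0\<close> show False by simp
  qed
qed

text \<open>Irrationality of \<phi>: squaring and \<phi>^2 = \<phi> + 1 leave a quadratic equation
  in naturals that the descent excludes.\<close>

lemma golden_ratio_mult_nat_neq:
  fixes x y :: nat
  assumes "y > 0"
  shows "real x \<noteq> real y * golden_ratio"
proof
  assume x: "real x = real y * golden_ratio"
  have "real x * real x = real y * real y * (golden_ratio * golden_ratio)"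
    by (simp add: x)
  also have "\<dots> = real x * real y + real y * real y"
    unfolding golden_ratio_square by (simp add: x algebra_simps)
  finally have "real (x * x) = real (x * y + y * y)"
    by simp
  then have "x * x = x * y + y * y"
    by (simp only: of_nat_eq_iff)
  with assms show False
    using golden_quadratic_form_zero by blast
qed

definition golden_floor :: "nat \<Rightarrow> nat" where
  "golden_floor n = nat \<lfloor>(real n + 1) / golden_ratio\<rfloor>"

lemma of_nat_golden_floor: "int (golden_floor n) = \<lfloor>(real n + 1) / golden_ratio\<rfloor>"
  using golden_ratio_gt_1 by (simp add: golden_floor_def)

lemma le_golden_floor_iff: "k \<le> golden_floor n \<longleftrightarrow> real k * golden_ratio \<le> real n + 1"
proof -
  have "k \<le> golden_floor n \<longleftrightarrow> int k \<le> \<lfloor>(real n + 1) / golden_ratio\<rfloor>"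
    by (simp flip: of_nat_golden_floor)
  also have "\<dots> \<longleftrightarrow> real k \<le> (real n + 1) / golden_ratio"
    by (simp add: le_floor_iff)
  finally show ?thesis
    using golden_ratio_gt_1 by (simp add: pos_le_divide_eq)
qed

lemma golden_floor_mono: "m \<le> n \<Longrightarrow> golden_floor m \<le> golden_floor n"
  using le_golden_floor_iff[of "golden_floor m" m] by (simp add: le_golden_floor_iff)

lemma golden_floor_pos: "n \<ge> 1 \<Longrightarrow> golden_floor n \<ge> 1"
  using golden_ratio_less_2 by (simp add: le_golden_floor_iff)

text \<open>By \<open>1 / \<phi> = \<phi> - 1\<close>, both sides compare \<open>n + 1\<close> with \<open>(m + 1) \<phi>\<close>; irrationality of \<open>\<phi>\<close>
  makes up for the strict inequality on one side.\<close>

lemma golden_floor_le_iff: "golden_floor n \<le> m \<longleftrightarrow> n \<le> golden_floor m + m"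
proof -
  let ?g = golden_ratio
  have "golden_floor n \<le> m \<longleftrightarrow> \<not> Suc m \<le> golden_floor n"
    by auto
  also have "\<dots> \<longleftrightarrow> real (Suc n) < real (Suc m) * ?g"
    unfolding le_golden_floor_iff by (simp add: not_le add.commute)
  finally have l: "golden_floor n \<le> m \<longleftrightarrow> real (Suc n) \<le> real (Suc m) * ?g"
    using golden_ratio_mult_nat_neq[of "Suc m" "Suc n"] by auto
  show ?thesis
  \<comment> \<open>For \<open>n \<le> m\<close> both sides hold; otherwise \<open>n - m\<close> is
    not truncated and passes to the reals.\<close>
  proof (cases "n \<le> m")
    case True
    then have "real (Suc n) \<le> real (Suc m)"
      by simp
    also have "\<dots> \<le> real (Suc m) * ?g"
      using golden_ratio_gt_1 by simp
    finally show ?thesis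
      using l True by simp
  next
    case False
    have "n \<le> golden_floor m + m \<longleftrightarrow> n - m \<le> golden_floor m"
      by auto
    also have "\<dots> \<longleftrightarrow> (real n - real m) * ?g \<le> real m + 1"
      using False by (simp add: le_golden_floor_iff of_nat_diff)
    \<comment> \<open>Add (m + 1) \<phi> to both sides and use \<phi> + 1 = \<phi>^2.\<close>
    also have "\<dots> \<longleftrightarrow> ?g * real (Suc n) \<le> ?g * (real (Suc m) * ?g)"
    proof -
      have "?g * (real (Suc m) * ?g) = real (Suc m) * (?g + 1)"
        by (simp flip: golden_ratio_square)
      then show ?thesis
        by (simp add: algebra_simps)
    qed
    also have "\<dots> \<longleftrightarrow> real (Suc n) \<le> real (Suc m) * ?g"
      using golden_ratio_gt_1 by (subst mult_le_cancel_left_pos) auto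
    finally show ?thesis
      using l by blast
  qed
qed

lemma golden_floor_le: "golden_floor n \<le> n"
  by (simp add: golden_floor_le_iff)

text \<open>Row \<open>m\<close> precedes the jump of \<open>Suc m\<close>, hence the
  \<open>Suc m\<close> in the position; \<open>earlier\<close> locates the window of each
  jump.\<close>

lemma hurt_sada_position_before_jump:
  assumes n: "n \<ge> 1"
    and earlier: "\<And>k. 1 \<le> k \<Longrightarrow> k < n \<Longrightarrow> hurt_sada (k - 1) (golden_floor k) = k"
    and "m < n"
  shows "hurt_sada m (if m < golden_floor n then n else n + golden_floor n - Suc m) = n"
  using \<open>m < n\<close>
proof (induction m)
  case 0
  then show ?case
    using golden_floor_pos[OF n] by simp
next
  case (Suc m)
  define i where "i = golden_floor (Suc m)"
  have step: "hurt_sada (Suc m) j =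
      (if j < i then hurt_sada m j
       else if j < i + Suc m then hurt_sada m (j + 1)
       else if j = i + Suc m then Suc m
       else hurt_sada m j)" for j
    using hurt_sada_step[of "Suc m" i j] earlier[of "Suc m"] Suc.prems by (simp add: i_def)
  have window: "golden_floor n \<le> Suc m \<longleftrightarrow> n \<le> i + Suc m"
    unfolding i_def by (rule golden_floor_le_iff)
  have "i \<le> golden_floor n"
    unfolding i_def using Suc.prems by (intro golden_floor_mono) simp
  show ?case
  proof (cases "Suc m < golden_floor n")
    case True
    then have "hurt_sada (Suc m) n = hurt_sada m n"
      unfolding step[of n] using window by auto
    then show ?thesis
      using Suc True by (simp del: hurt_sada.simps)
  next
    case False
    define j where "j = n + golden_floor n - Suc (Suc m)"
    \<comment> \<open>\<open>Suc m < n\<close> gives \<open>golden_floor n \<le> j\<close>, and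
      \<open>golden_floor n \<le> Suc m\<close> gives \<open>j < n\<close>.\<close>
    have "i \<le> j" "j < i + Suc m"
      using False window Suc.prems \<open>i \<le> golden_floor n\<close> by (auto simp: j_def)
    then have "hurt_sada (Suc m) j = hurt_sada m (j + 1)"
      unfolding step[of j] by simp
    \<comment> \<open>At the first move \<open>golden_floor n = Suc m\<close>, so
      \<open>j + 1 = n\<close>.\<close>
    also have "j + 1 = (if m < golden_floor n then n else n + golden_floor n - Suc m)"
      using False Suc.prems by (auto simp: j_def)
    finally show ?thesis
      using Suc False by (simp add: j_def del: hurt_sada.simps)
  qed
qed

lemma hurt_sada_golden_floor:
  assumes "n \<ge> 1"
  shows "hurt_sada (n - 1) (golden_floor n) = n"
  using assms
proof (induction n rule: less_induct)
  case (less n)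
  have "hurt_sada (n - 1) (if n - 1 < golden_floor n then n else n + golden_floor n - Suc (n - 1)) = n"
    using less by (intro hurt_sada_position_before_jump) auto
  \<comment> \<open>The first branch forces \<open>golden_floor n = n\<close>.\<close>
  moreover have "(if n - 1 < golden_floor n then n else n + golden_floor n - Suc (n - 1)) = golden_floor n"
    using less.prems golden_floor_le[of n] by auto
  ultimately show ?case
    by simp
qed

theorem theorem4:
  fixes n :: nat
  assumes "n \<ge> 1"
  shows "int (hs_pos n) = \<lfloor>(real n + 1) / golden_ratio\<rfloor>"
proof -
  have "hs_pos n = golden_floor n"
    using hurt_sada_ex1[of "n - 1" n] hurt_sada_pred_hs_pos[of n] hurt_sada_golden_floor[OF assms]
    by blast
  then show ?thesis
    by (simp add: of_nat_golden_floor)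
qed

end
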